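(* For all integers $r\ge 2$ and all positive integers $n$, $a_n^I(FS_r)\ge L^I(n,r)$, where $$L^I(n,r)=\sum_{i=0}^{K(n,r)}\binom{h(n-i,r)-1}{i},\qquad h(n,r)=\frac{r-1}{r}(n+1)+1,\qquad K(n,r)=\left\lfloor\frac{r-1}{2r-1}(n+1)\right\rfloor .$$
   Context: $FS_r$ is the free semigroup of rank $r$, i.e. all non-empty words over an alphabet of $r$ letters under concatenation. The (Rees) index of a subset $T\subseteq S$ is $|S\setminus T|$. A (two-sided) ideal $I$ of a semigroup $S$ is a subsemigroup with $SI\subseteq I$ and $IS\subseteq I$. $a_n^I(FS_r)$ denotes the number of two-sided ideals of $FS_r$ of Rees index exactly $n$. Binomial coefficients with a real upper argument $x$ and integer $i\ge 0$ are understood via the usual extension (by Gamma functions), $\binom{x}{i}=x(x-1)\cdots(x-i+1)/i!$. *)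

theory Defs
  imports Complex_Main
begin

definition subsemigroup :: "('a \<Rightarrow> 'a \<Rightarrow> 'a) \<Rightarrow> 'a set \<Rightarrow> 'a set \<Rightarrow> bool" where
  "subsemigroup mul S T \<longleftrightarrow> T \<noteq> {} \<and> T \<subseteq> S \<and> (\<forall>x\<in>T. \<forall>y\<in>T. mul x y \<in> T)"

definition two_sided_ideal :: "('a \<Rightarrow> 'a \<Rightarrow> 'a) \<Rightarrow> 'a set \<Rightarrow> 'a set \<Rightarrow> bool" where
  "two_sided_ideal mul S I \<longleftrightarrow> subsemigroup mul S I \<and>
     (\<forall>s\<in>S. \<forall>x\<in>I. mul s x \<in> I) \<and> (\<forall>x\<in>I. \<forall>s\<in>S. mul x s \<in> I)"

text \<open>Finiteness is required separately because the cardinality of an infinite set is 0.\<close>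

definition has_rees_index :: "'a set \<Rightarrow> 'a set \<Rightarrow> nat \<Rightarrow> bool" where
  "has_rees_index S T n \<longleftrightarrow> finite (S - T) \<and> card (S - T) = n"

definition FS :: "nat \<Rightarrow> nat list set" where
  "FS r = {w. w \<noteq> [] \<and> set w \<subseteq> {..<r}}"

definition ideal_count :: "nat \<Rightarrow> nat \<Rightarrow> nat" where
  "ideal_count n r = card {I. two_sided_ideal (@) (FS r) I \<and> has_rees_index (FS r) I n}"

text \<open>The first argument of \<open>h\<close> is real, so that \<open>n - i\<close> below is not truncated subtraction.\<close>

definition h :: "real \<Rightarrow> nat \<Rightarrow> real" where
  "h x r = (real r - 1) / real r * (x + 1) + 1"

definition K :: "nat \<Rightarrow> nat \<Rightarrow> int" where
  "K n r = \<lfloor>(real r - 1) / (2 * real r - 1) * (real n + 1)\<rfloor>"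

text \<open>For \<open>r \<ge> 1\<close> the bound \<open>K n r\<close> is nonnegative, so \<open>nat\<close> loses nothing.\<close>

definition L_I :: "nat \<Rightarrow> nat \<Rightarrow> real" where
  "L_I n r = (\<Sum>i = 0..nat (K n r). (h (real n - real i) r - 1) gchoose i)"

end

theory Submission
  imports Defs
begin

text \<open>
  Write an ideal as the complement of a factor-closed language. If \<open>D\<close> is factor-closed and \<open>S\<close> is
  any set of minimal forbidden words of \<open>D\<close> (equivalently, minimal generators of the complementary
  ideal), then \<open>D \<union> S\<close> is factor-closed. Let \<open>D\<^sub>m\<close> consist of the first \<open>m + 1\<close> words in
  length-lexicographic order and let \<open>g\<^sub>m\<close>, of length \<open>L\<close>, be the next word. The map sending a word
  \<open>v\<close> of length \<open>L\<close> to \<open>v\<close> if \<open>v \<notin> D\<^sub>m\<close> and to \<open>0v\<close> otherwise is an injection into the minimal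
  forbidden words, so there are at least \<open>r ^ L \<ge> h m r\<close> of them. The ideals counted by the \<open>i\<close>-th
  summand arise by adding to \<open>D\<^sub>m\<close>, \<open>m = n - i\<close>, any \<open>i\<close> of these words other than \<open>g\<^sub>m\<close>; leaving
  out \<open>g\<^sub>m\<close> makes the families for different \<open>i\<close> disjoint.
\<close>

section \<open>Finite-index ideals as complements of factor-closed sets\<close>

definition factor_closed :: "'a list set \<Rightarrow> bool" where
  "factor_closed D \<longleftrightarrow> (\<forall>x y. x @ y \<in> D \<longrightarrow> x \<in> D \<and> y \<in> D)"

lemma factor_closedD:
  assumes "factor_closed D" "x @ y \<in> D"
  shows "x \<in> D" "y \<in> D"
  using assms unfolding factor_closed_def by blast+

lemma FS_eq: "FS r = lists {..<r} - {[]}"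
  by (auto simp: FS_def in_lists_conv_set)

lemma infinite_lists_lessThan:
  assumes "r \<ge> 1"
  shows "infinite (lists {..<r::nat})"
proof -
  have "inj (\<lambda>n. replicate n (0::nat))"
    by (rule inj_on_inverseI[where g = length]) simp
  moreover have "range (\<lambda>n. replicate n 0) \<subseteq> lists {..<r}"
    using assms by auto
  ultimately show ?thesis
    by (meson finite_imageD finite_subset infinite_UNIV_nat)
qed

text \<open>Factor-closure is the absorption property of the complement, read contrapositively;
  finiteness of \<open>D\<close> keeps the complement nonempty, as \<open>subsemigroup\<close>
  demands.\<close>

lemma two_sided_ideal_lists_Diff:
  fixes D :: "nat list set"
  assumes "r \<ge> 1" "finite D" "factor_closed D" "[] \<in> D"
  shows "two_sided_ideal (@) (FS r) (lists {..<r} - D)"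
proof -
  have "lists {..<r} - D \<noteq> {}"
    using infinite_lists_lessThan[OF assms(1)] assms(2)
    by (metis Diff_eq_empty_iff finite_subset)
  moreover have "lists {..<r} - D \<subseteq> FS r"
    using assms(4) by (auto simp: FS_eq)
  ultimately show ?thesis
    unfolding two_sided_ideal_def subsemigroup_def
    by (auto simp: FS_eq dest: factor_closedD[OF assms(3)])
qed

text \<open>The empty word lies in \<open>D\<close> but not in \<open>FS r\<close>, hence
  \<open>Suc n\<close>.\<close>

lemma has_rees_index_lists_Diff:
  assumes "finite D" "[] \<in> D" "D \<subseteq> lists {..<r}" "card D = Suc n"
  shows "has_rees_index (FS r) (lists {..<r} - D) n"
proof -
  have "FS r - (lists {..<r} - D) = D - {[]}"
    using assms by (auto simp: FS_eq)
  then show ?thesis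
    using assms by (simp add: has_rees_index_def)
qed

text \<open>All nonempty prefixes of \<open>w\<close> avoid \<open>I\<close>, since \<open>I\<close>
  absorbs on the right, and there are \<open>length w\<close> of them.\<close>

lemma length_le_rees_index:
  assumes "two_sided_ideal (@) (FS r) I" "has_rees_index (FS r) I n" "w \<in> FS r - I"
  shows "length w \<le> n"
proof -
  have "take i w \<in> FS r - I" if "i \<in> {1..length w}" for i
  proof (cases "i = length w")
    case False
    have "w \<noteq> []" "set w \<subseteq> {..<r}"
      using assms(3) by (auto simp: FS_def)
    then have t: "take i w \<in> FS r" "drop i w \<in> FS r"
      using that False set_take_subset[of i w] set_drop_subset[of i w] by (auto simp: FS_def)
    have "take i w \<notin> I"
    proof
      assume "take i w \<in> I"
      then have "take i w @ drop i w \<in> I"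
        using assms(1) t(2) unfolding two_sided_ideal_def by blast
      then show False
        using assms(3) by simp
    qed
    with t show ?thesis
      by simp
  qed (use assms in simp)
  moreover have "inj_on (\<lambda>i. take i w) {1..length w}"
    by (rule inj_on_inverseI[where g = length]) auto
  ultimately have "card {1..length w} \<le> card (FS r - I)"
    using assms(2) by (intro card_inj_on_le[where f = "\<lambda>i. take i w"]) (auto simp: has_rees_index_def)
  then show ?thesis
    using assms(2) by (simp add: has_rees_index_def)
qed

text \<open>On an infinite family \<open>card\<close> would be 0, so any lower bound on
  \<open>ideal_count\<close> rests on this. Complements contain only words of length at most
  \<open>n\<close>, which leaves finitely many choices.\<close>

lemma finite_ideals_rees_index:
  "finite {I. two_sided_ideal (@) (FS r) I \<and> has_rees_index (FS r) I n}" (is "finite ?A")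
proof (rule finite_imageD)
  let ?W = "{w. set w \<subseteq> {..<r} \<and> length w \<le> n}"
  have "(-) (FS r) ` ?A \<subseteq> Pow ?W"
    using length_le_rees_index by (fastforce simp: FS_def)
  moreover have "finite (Pow ?W)"
    by (simp add: finite_lists_length_le)
  ultimately show "finite ((-) (FS r) ` ?A)"
    using finite_subset by blast
  show "inj_on ((-) (FS r)) ?A"
    by (rule inj_on_inverseI[where g = "(-) (FS r)"])
      (auto simp: two_sided_ideal_def subsemigroup_def)
qed

lemma card_le_ideal_count:
  assumes "r \<ge> 1"
    and \<F>: "\<And>D. D \<in> \<F> \<Longrightarrow> finite D \<and> factor_closed D \<and> [] \<in> D \<and> D \<subseteq> lists {..<r} \<and> card D = Suc n"
  shows "card \<F> \<le> ideal_count n r"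
  unfolding ideal_count_def
proof (rule card_inj_on_le)
  show "inj_on ((-) (lists {..<r})) \<F>"
    by (rule inj_on_inverseI[where g = "(-) (lists {..<r})"]) (use \<F> in blast)
  show "(-) (lists {..<r}) ` \<F> \<subseteq> {I. two_sided_ideal (@) (FS r) I \<and> has_rees_index (FS r) I n}"
    using \<F> assms(1) by (auto intro!: two_sided_ideal_lists_Diff has_rees_index_lists_Diff)
qed (rule finite_ideals_rees_index)

section \<open>Minimal forbidden words\<close>

definition min_forbidden :: "'a list set \<Rightarrow> 'a list set" where
  "min_forbidden D = {g. g \<notin> D \<and> butlast g \<in> D \<and> tl g \<in> D}"

text \<open>A proper factor of a word \<open>g\<close> in \<open>S\<close> is a factor of
  \<open>butlast g\<close> or of \<open>tl g\<close>, so it already lies in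
  \<open>D\<close>.\<close>

lemma factor_closed_Un_min_forbidden:
  assumes "factor_closed D" "S \<subseteq> min_forbidden D"
  shows "factor_closed (D \<union> S)"
  unfolding factor_closed_def
proof (intro allI impI)
  fix x y
  assume "x @ y \<in> D \<union> S"
  then consider "x @ y \<in> D" | "x = [] \<or> y = []" "x @ y \<in> S"
    | "x \<noteq> []" "y \<noteq> []" "x @ y \<in> S"
    by blast
  then show "x \<in> D \<union> S \<and> y \<in> D \<union> S"
  proof cases
    case 1
    then show ?thesis
      using factor_closedD[OF assms(1)] by blast
  next
    case 2
    then have "butlast (x @ y) \<in> D"
      using assms(2) by (auto simp: min_forbidden_def)
    then have "[] \<in> D"
      using factor_closedD(1)[OF assms(1), of "[]"] by simp
    then show ?thesis
      using 2(1,2) by auto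
  next
    case 3
    then have "butlast (x @ y) \<in> D" "tl (x @ y) \<in> D"
      using assms(2) by (auto simp: min_forbidden_def)
    then show ?thesis
      using 3 factor_closedD(1)[OF assms(1), of x "butlast y"]
        factor_closedD(2)[OF assms(1), of "tl x" y] by (simp add: butlast_append)
  qed
qed

section \<open>Positions in length-lexicographic order\<close>

text \<open>The position of a word over \<open>{..<r}\<close> in length-lexicographic order, i.e. its value in
  bijective base \<open>r\<close> notation with digit \<open>a + 1\<close> for the letter \<open>a\<close>.\<close>

definition slval :: "nat \<Rightarrow> nat list \<Rightarrow> nat" where
  "slval r w = foldl (\<lambda>x a. r * x + a + 1) 0 w"

lemma slval_Nil [simp]: "slval r [] = 0"
  by (simp add: slval_def)

lemma slval_snoc [simp]: "slval r (w @ [a]) = r * slval r w + a + 1"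
  by (simp add: slval_def)

lemma slval_Cons: "slval r (a # w) = (a + 1) * r ^ length w + slval r w"
proof (induction w rule: rev_induct)
  case (snoc b w)
  then show ?case
    using slval_snoc[of r "a # w" b] by (simp add: algebra_simps)
qed (simp add: slval_def)

text \<open>Subtracting 1 from the position and dividing by \<open>r\<close> recovers the last
  letter as remainder and the position of the rest as quotient.\<close>

lemma inj_on_slval: "inj_on (slval r) (lists {..<r})"
proof -
  have "u = w" if "u \<in> lists {..<r}" "w \<in> lists {..<r}" "slval r u = slval r w" for u w
    using that
  proof (induction u arbitrary: w rule: rev_induct)
    case Nil
    then show ?case
      by (cases w rule: rev_cases) auto
  next
    case (snoc a u)
    obtain v b where w: "w = v @ [b]"
      using snoc.prems by (cases w rule: rev_cases) auto
    have ab: "a < r" "b < r" and eq: "r * slval r u + a = r * slval r v + b"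
      using snoc.prems w by auto
    have "slval r u = slval r v" "a = b"
      using arg_cong[OF eq, of "\<lambda>x. x div r"] arg_cong[OF eq, of "\<lambda>x. x mod r"] ab by auto
    then show ?case
      using snoc w by auto
  qed
  then show ?thesis
    by (rule inj_onI)
qed

lemma slval_image:
  assumes "r \<ge> 1"
  shows "slval r ` lists {..<r} = UNIV"
proof -
  have "\<exists>w\<in>lists {..<r}. slval r w = m" for m
  proof (induction m rule: less_induct)
    case (less m)
    show ?case
    proof (cases m)
      case 0
      then show ?thesis
        by (intro bexI[of _ "[]"]) auto
    next
      case (Suc k)
      \<comment> \<open>The word at position \<open>k div r\<close>, followed by the letter
        \<open>k mod r\<close>, has position \<open>k + 1 = m\<close>.\<close>
      have "k div r < m"
        using Suc by (simp add: le_imp_less_Suc)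
      then obtain w where "w \<in> lists {..<r}" "slval r w = k div r"
        using less by blast
      then show ?thesis
        using assms Suc by (intro bexI[of _ "w @ [k mod r]"]) auto
    qed
  qed
  then show ?thesis
    by (metis UNIV_eq_I imageI)
qed

text \<open>The words of length \<open>L\<close> occupy the positions from \<open>s\<close> to \<open>r * s\<close> with
  \<open>s = (r ^ L - 1) / (r - 1)\<close>; multiplying by \<open>r - 1\<close> avoids the division.\<close>

lemma slval_ge:
  assumes "r \<ge> 1" shows "r ^ length w \<le> (r - 1) * slval r w + 1"
proof (induction w rule: rev_induct)
  case (snoc a w)
  obtain q where r: "r = Suc q"
    using assms by (cases r) auto
  have "r ^ length w \<le> q * slval r w + 1"
    using snoc r by simp
  then have "r * r ^ length w \<le> r * (q * slval r w + 1)"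
    by (rule mult_le_mono2)
  also have "\<dots> \<le> (r - 1) * slval r (w @ [a]) + 1"
    by (simp add: r algebra_simps)
  finally show ?case
    by simp
qed simp

text \<open>Equality holds for the word all of whose letters are \<open>r - 1\<close>.\<close>

lemma slval_le:
  assumes "r \<ge> 1" "w \<in> lists {..<r}"
  shows "(r - 1) * slval r w + r \<le> r * r ^ length w"
  using assms(2)
proof (induction w rule: rev_induct)
  case (snoc a w)
  obtain q where r: "r = Suc q"
    using assms by (cases r) auto
  have "q * a \<le> q * q"
    using snoc.prems r by (intro mult_le_mono2) auto
  then have "r * (q * slval r w) + q * a + q + r \<le> r * (q * slval r w) + q * q + q + r"
    by linarith
  also have "\<dots> = r * (q * slval r w + r)"
    by (simp add: r algebra_simps)
  also have "\<dots> \<le> r * (r * r ^ length w)"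
    using snoc r by (intro mult_le_mono2) auto
  finally show ?case
    by (simp add: r algebra_simps)
qed simp

text \<open>The last position of one length lies just below the first position of the next;
  \<open>r \<ge> 2\<close> allows cancelling \<open>r - 1\<close>.\<close>

lemma slval_less_if_length_less:
  assumes "r \<ge> 2" "v \<in> lists {..<r}" "length v < length w"
  shows "slval r v < slval r w"
proof -
  have "r * r ^ length v \<le> r ^ length w"
    using assms by (metis Suc_leI le_trans one_le_numeral power_Suc power_increasing)
  then have "(r - 1) * slval r v + r \<le> (r - 1) * slval r w + 1"
    using slval_le[of r v] slval_ge[of r w] assms by linarith
  then have "(r - 1) * slval r v < (r - 1) * slval r w"
    using assms(1) by linarith
  then show ?thesis
    by simp
qed

text \<open>Prepending 0 to \<open>u = butlast v\<close> adds \<open>r ^ length u\<close>, at most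
  \<open>(r - 1) * slval r u + 1\<close>. This will put \<open>butlast (0 # v)\<close> into any
  initial segment containing \<open>v\<close>.\<close>

lemma slval_zero_butlast_le:
  assumes "r \<ge> 1" "v \<noteq> []"
  shows "slval r (0 # butlast v) \<le> slval r v"
proof -
  obtain u a where v: "v = u @ [a]"
    using assms(2) by (cases v rule: rev_cases) auto
  obtain q where r: "r = Suc q"
    using assms by (cases r) auto
  show ?thesis
    using slval_ge[OF assms(1), of u] v r by (simp add: slval_Cons)
qed

section \<open>Initial segments and their minimal forbidden words\<close>

definition slprefix :: "nat \<Rightarrow> nat \<Rightarrow> nat list set" where
  "slprefix r m = {w \<in> lists {..<r}. slval r w \<le> m}"

lemma slprefix_card:
  assumes "r \<ge> 1"
  shows "finite (slprefix r m)" "card (slprefix r m) = Suc m"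
proof -
  have "bij_betw (slval r) (slprefix r m) {..m}"
    unfolding bij_betw_def
  proof
    show "inj_on (slval r) (slprefix r m)"
      using inj_on_slval by (rule inj_on_subset) (auto simp: slprefix_def)
    have "k \<in> slval r ` slprefix r m" if "k \<le> m" for k
    proof -
      have "k \<in> slval r ` lists {..<r}"
        using slval_image[OF assms] by simp
      then show ?thesis
        using that by (auto simp: slprefix_def)
    qed
    then show "slval r ` slprefix r m = {..m}"
      by (auto simp: slprefix_def)
  qed
  then show "finite (slprefix r m)" "card (slprefix r m) = Suc m"
    using bij_betw_finite bij_betw_same_card by fastforce+
qed

text \<open>Extending a word on either side never lowers its position.\<close>

lemma factor_closed_slprefix:
  assumes "r \<ge> 1"
  shows "factor_closed (slprefix r m)"
proof -
  have prefix: "slval r x \<le> slval r (x @ y)" for x y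
  proof (induction y rule: rev_induct)
    case (snoc a y)
    have "slval r (x @ y) \<le> r * slval r (x @ y)"
      using assms by simp
    moreover have "slval r (x @ y @ [a]) = r * slval r (x @ y) + a + 1"
      using slval_snoc[of r "x @ y" a] by simp
    ultimately show ?case
      using snoc by linarith
  qed simp
  have suffix: "slval r y \<le> slval r (x @ y)" for x y
    by (induction x) (auto simp: slval_Cons)
  show ?thesis
    by (auto simp: factor_closed_def slprefix_def
        intro: le_trans[OF prefix] le_trans[OF suffix])
qed

lemma exists_min_forbidden_slprefix:
  assumes "r \<ge> 2"
  obtains g G where "slval r g = Suc m" "g \<in> G" "G \<subseteq> min_forbidden (slprefix r m)"
    "G \<subseteq> lists {..<r}" "finite G" "h (real m) r \<le> real (card G)"
proof -
  let ?D = "slprefix r m"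
  have "Suc m \<in> slval r ` lists {..<r}"
    using slval_image[of r] assms by simp
  then obtain g where g: "g \<in> lists {..<r}" "slval r g = Suc m"
    by (metis imageE)
  define L where "L = length g"
  define W where "W = {v. set v \<subseteq> {..<r} \<and> length v = L}"
  define f where "f v = (if v \<in> ?D then 0 # v else v)" for v
  have short: "v \<in> ?D" if "v \<in> lists {..<r}" "length v < L" for v
    using slval_less_if_length_less[OF assms that(1), of g] that g by (auto simp: slprefix_def L_def)
  have long: "v \<notin> ?D" if "length v > L" for v
    using slval_less_if_length_less[OF assms g(1), of v] that g by (auto simp: slprefix_def L_def)
  have L: "L \<noteq> 0"
    using g by (auto simp: L_def)
  have W: "finite W" "card W = r ^ L"
    unfolding W_def by (simp_all add: finite_lists_length_eq card_lists_length_eq)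
  \<comment> \<open>Words altered by \<open>f\<close> get length \<open>L + 1\<close> and the others
    keep length \<open>L\<close>, so the two cases cannot collide.\<close>
  have "inj_on f W"
    by (rule inj_onI) (auto simp: f_def W_def split: if_splits)
  then have card: "card (f ` W) = r ^ L"
    using W card_image by metis
  have mf: "f v \<in> min_forbidden ?D" if "v \<in> W" for v
  proof -
    have v: "v \<in> lists {..<r}" "length v = L" "v \<noteq> []"
      using that L by (auto simp: W_def)
    show ?thesis
    proof (cases "v \<in> ?D")
      case True
      have "slval r (0 # butlast v) \<le> m"
        using slval_zero_butlast_le[of r v] v True assms by (auto simp: slprefix_def)
      moreover have "0 # butlast v \<in> lists {..<r}"
        using v assms by (auto dest: in_set_butlastD)
      \<comment> \<open>Here \<open>tl (0 # v) = v\<close> is in \<open>?D\<close> by assumption,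
        while \<open>0 # v\<close> is too long to be.\<close>
      ultimately show ?thesis
        using True v long[of "0 # v"] by (auto simp: f_def min_forbidden_def slprefix_def)
    next
      case False
      have "butlast v \<in> ?D" "tl v \<in> ?D"
        using v L by (auto intro!: short dest: in_set_butlastD list.set_sel(2)[rotated])
      then show ?thesis
        using False by (simp add: f_def min_forbidden_def)
    qed
  qed
  have "f g = g"
    using g by (simp add: f_def slprefix_def)
  then have "g \<in> f ` W"
    using g by (metis (mono_tags, lifting) L_def W_def image_eqI in_lists_conv_set mem_Collect_eq subsetI)
  moreover have "f ` W \<subseteq> lists {..<r}"
    using assms by (auto simp: f_def W_def)
  moreover have "h (real m) r \<le> real (card (f ` W))"
  proof -
    \<comment> \<open>Dividing by \<open>r\<close> turns this into
      \<open>h m r \<le> r ^ L\<close>.\<close>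
    have "(r - 1) * Suc m + r \<le> r * r ^ L"
      using slval_le[of r g] g assms by (simp add: L_def)
    then have "real (r - 1) * real (Suc m) + real r \<le> real r * real r ^ L"
      by (metis of_nat_add of_nat_le_iff of_nat_mult of_nat_power)
    then have "(real r - 1) * (real m + 1) + real r \<le> real r * real r ^ L"
      using assms by (simp add: of_nat_diff add.commute)
    then show ?thesis
      using assms card by (simp add: h_def field_simps)
  qed
  ultimately show thesis
    using that[of g "f ` W"] g mf W by blast
qed

section \<open>Summing over the number of added words\<close>

text \<open>The inequality is \<open>i \<le> h (n - i) r - 1\<close> cleared of
  denominators.\<close>

lemma K_bound:
  assumes "r \<ge> 1" "i \<le> nat (K n r)"
  shows "real i * (2 * real r - 1) \<le> (real r - 1) * (real n + 1)"
proof -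
  let ?x = "(real r - 1) / (2 * real r - 1) * (real n + 1)"
  have "?x \<ge> 0"
    using assms by simp
  then have "real i \<le> ?x"
    using assms(2) unfolding K_def by linarith
  then show ?thesis
    using assms(1) by (simp add: field_simps)
qed

theorem theorem6p6:
  fixes r n :: nat
  assumes "r \<ge> 2" and "n \<ge> 1"
  shows "real (ideal_count n r) \<ge> L_I n r"
proof -
  have r1: "r \<ge> 1"
    using assms by simp
  have "\<forall>m. \<exists>g G. slval r g = Suc m \<and> g \<in> G \<and> G \<subseteq> min_forbidden (slprefix r m) \<and>
      G \<subseteq> lists {..<r} \<and> finite G \<and> h (real m) r \<le> real (card G)"
    using exists_min_forbidden_slprefix[OF assms(1)] by metis
  then obtain g G where gG: "\<And>m. slval r (g m) = Suc m" "\<And>m. g m \<in> G m"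
      "\<And>m. G m \<subseteq> min_forbidden (slprefix r m)" "\<And>m. G m \<subseteq> lists {..<r}"
      "\<And>m. finite (G m)" "\<And>m. h (real m) r \<le> real (card (G m))"
    by metis
  let ?k = "nat (K n r)"
  define B where "B i = {S. S \<subseteq> G (n - i) - {g (n - i)} \<and> card S = i}" for i
  define \<F> where "\<F> i = (\<lambda>S. slprefix r (n - i) \<union> S) ` B i" for i
  have disj: "S \<inter> slprefix r (n - i) = {}" if "S \<in> B i" for S i
    using that gG(3)[of "n - i"] by (auto simp: B_def min_forbidden_def)
  \<comment> \<open>The first bound is the threshold for monotonicity of \<open>gchoose i\<close>;
    the second makes the natural subtraction \<open>n - i\<close> exact.\<close>
  have k: "real i \<le> (real r - 1) / real r * (real n - real i + 1)" "i \<le> n" if "i \<le> ?k" for i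
  proof -
    note b = K_bound[OF r1 that]
    show "real i \<le> (real r - 1) / real r * (real n - real i + 1)"
    proof -
      have "real i * real r \<le> (real r - 1) * (real n - real i + 1)"
        using b by (simp add: algebra_simps)
      then show ?thesis
        using assms(1) by (simp add: pos_le_divide_eq)
    qed
    have "(real r - 1) * (real n + 1) < (2 * real r - 1) * (real n + 1)"
      by (rule mult_strict_right_mono) (use assms(1) in auto)
    with b have "real i * (2 * real r - 1) < (2 * real r - 1) * (real n + 1)"
      by (rule order_le_less_trans)
    then have "(2 * real r - 1) * real i < (2 * real r - 1) * (real n + 1)"
      by (simp only: mult.commute[of "real i"])
    then have "real i < real n + 1"
      by (rule mult_left_less_imp_less) (use assms(1) in auto)
    then show "i \<le> n"
      by linarith
  qed
  have cardB: "(h (real n - real i) r - 1) gchoose i \<le> real (card (\<F> i))" if "i \<le> ?k" for i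
  proof -
    have "inj_on (\<lambda>S. slprefix r (n - i) \<union> S) (B i)"
      using disj by (intro inj_onI) blast
    then have "card (\<F> i) = card (B i)"
      unfolding \<F>_def by (rule card_image)
    also have "\<dots> = (card (G (n - i)) - 1) choose i"
      unfolding B_def using gG(2,5) by (subst n_subsets) auto
    finally have c: "real (card (\<F> i)) = (real (card (G (n - i)) - 1)) gchoose i"
      by (simp add: binomial_gbinomial)
    have "card (G (n - i)) \<ge> 1"
      using gG(2,5) by (metis card_0_eq empty_iff less_one not_less)
    \<comment> \<open>\<open>gbinomial_mono\<close> requires the smaller upper argument to be at
      least \<open>i\<close>, which \<open>k\<close> supplies.\<close>
    then show ?thesis
      unfolding c using k[OF that] gG(6)[of "n - i"]
      by (intro gbinomial_mono) (auto simp: h_def of_nat_diff)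
  qed
  have fin: "finite (\<F> i)" for i
    unfolding \<F>_def B_def using gG(5) by (intro finite_imageI) (simp add: finite_subset)
  have dist: "\<F> i \<inter> \<F> j = {}" if "i < j" "j \<le> ?k" for i j
  proof -
    \<comment> \<open>Its position is \<open>n - j + 1 \<le> n - i\<close>, so every member of
      \<open>\<F> i\<close> contains \<open>g (n - j)\<close>, whereas no member of
      \<open>\<F> j\<close> does.\<close>
    have "g (n - j) \<in> slprefix r (n - i)"
      using that k(2)[OF that(2)] gG(1,2,4) by (fastforce simp: slprefix_def)
    moreover have "g (n - j) \<notin> slprefix r (n - j)"
      using gG(1) by (simp add: slprefix_def)
    ultimately show ?thesis
      by (auto simp: \<F>_def B_def)
  qed
  have "L_I n r \<le> (\<Sum>i = 0..?k. real (card (\<F> i)))"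
    unfolding L_I_def using cardB by (intro sum_mono) auto
  also have "\<dots> = real (card (\<Union>i\<in>{0..?k}. \<F> i))"
  proof (subst card_UN_disjoint)
    show "\<forall>i\<in>{0..?k}. \<forall>j\<in>{0..?k}. i \<noteq> j \<longrightarrow> \<F> i \<inter> \<F> j = {}"
      using dist by (metis Int_commute atLeastAtMost_iff linorder_neqE_nat)
  qed (use fin in auto)
  also have "\<dots> \<le> real (ideal_count n r)"
  proof (intro of_nat_mono card_le_ideal_count[OF r1])
    fix D
    assume "D \<in> (\<Union>i\<in>{0..?k}. \<F> i)"
    then obtain i S where i: "i \<le> ?k" and S: "S \<in> B i" and D: "D = slprefix r (n - i) \<union> S"
      by (auto simp: \<F>_def)
    have S': "S \<subseteq> G (n - i)" "card S = i" "finite S"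
      using S gG(5) finite_subset[of S "G (n - i)"] by (auto simp: B_def)
    have "card D = card (slprefix r (n - i)) + card S"
      unfolding D using disj[OF S] S' slprefix_card(1)[OF r1] by (intro card_Un_disjoint) auto
    then have "card D = Suc n"
      using slprefix_card(2)[OF r1] S' k(2)[OF i] by simp
    moreover have "factor_closed D"
      unfolding D using S' gG(3) by (intro factor_closed_Un_min_forbidden factor_closed_slprefix[OF r1]) blast
    moreover have "D \<subseteq> lists {..<r}"
      unfolding D using S' gG(4) by (fastforce simp: slprefix_def)
    moreover have "[] \<in> D"
      unfolding D by (simp add: slprefix_def)
    ultimately show "finite D \<and> factor_closed D \<and> [] \<in> D \<and> D \<subseteq> lists {..<r} \<and> card D = Suc n"
      unfolding D using slprefix_card(1)[OF r1] S' by simp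
  qed
  finally show ?thesis .
qed

end
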